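(* Let $X$ be an order continuous Banach lattice. Assume that there is a Hausdorff locally solid topology $\tau$ on $X$ such that order convergence and $\tau$-convergence coincide on each order interval of $X$; that is, for all $u\le v$ in $X$, every net $(x_\alpha)$ in $[u,v]$ and every $x\in[u,v]$, the net $(x_\alpha)$ is order convergent to $x$ in $X$ if and only if $x_\alpha\to x$ with respect to $\tau$. Then $X$ is atomic.
   Context: A locally solid topology on a vector lattice is a linear topology with a base at zero of solid sets (a set $S$ is solid if $|y|\le|x|$, $x\in S$ imply $y\in S$). The order interval $[u,v]$ is $\{z\in X: u\le z\le v\}$. A net $(x_\alpha)_{\alpha\in A}$ in a vector lattice $X$ is order convergent to $x\in X$ if there is a net $(y_\beta)_{\beta\in B}$ in $X$ (with a possibly different index set) such that $y_\beta\downarrow 0$ (decreasing with infimum $0$ in $X$) and for each $\beta\in B$ there is $\alpha_\beta\in A$ with $|x_\alpha-x|\le y_\beta$ for all $\alpha\ge\alpha_\beta$. A normed lattice $X$ is order continuous if $x_\alpha\downarrow 0$ implies $\|x_\alpha\|\downarrow 0$ for every net $(x_\alpha)$ in $X$. An element $a>0$ of $X$ is an atom if for every $y\in[0,a]$ there is a real $\lambda\ge 0$ with $y=\lambda a$. $X$ is atomic if the band generated by its atoms is $X$. *)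

theory Defs
  imports "HOL-Analysis.Analysis" "HOL-Library.Lattice_Algebras"
begin

class vector_lattice = lattice_ab_group_add_abs + ordered_real_vector

class normed_lattice = vector_lattice + real_normed_vector +
  assumes norm_abs_mono: "\<bar>x\<bar> \<le> \<bar>y\<bar> \<Longrightarrow> norm x \<le> norm y"

class banach_lattice = normed_lattice + banach

text \<open>
  A net is a triple: an index set \<open>A\<close>, a relation \<open>r\<close> directing it
  (\<open>r a b\<close> reads ``\<open>a \<le> b\<close>''), and a function on \<open>A\<close>.
\<close>

definition directed_set :: "'i set \<Rightarrow> ('i \<Rightarrow> 'i \<Rightarrow> bool) \<Rightarrow> bool" where
  "directed_set A r \<longleftrightarrow> A \<noteq> {} \<and> reflp_on A r \<and> transp_on A r \<and>
     (\<forall>a\<in>A. \<forall>b\<in>A. \<exists>c\<in>A. r a c \<and> r b c)"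

definition tail_filter :: "'i set \<Rightarrow> ('i \<Rightarrow> 'i \<Rightarrow> bool) \<Rightarrow> 'i filter" where
  "tail_filter A r = (INF a\<in>A. principal {b \<in> A. r a b})"

definition decreasing_to :: "'i set \<Rightarrow> ('i \<Rightarrow> 'i \<Rightarrow> bool) \<Rightarrow> ('i \<Rightarrow> 'b::order) \<Rightarrow> 'b \<Rightarrow> bool" where
  "decreasing_to A r y l \<longleftrightarrow>
     (\<forall>a\<in>A. \<forall>b\<in>A. r a b \<longrightarrow> y b \<le> y a) \<and>
     (\<forall>a\<in>A. l \<le> y a) \<and> (\<forall>z. (\<forall>a\<in>A. z \<le> y a) \<longrightarrow> z \<le> l)"

text \<open>
  HOL cannot quantify over all index types inside a formula. Where a definition or a
  hypothesis ranges over all nets in \<open>'a\<close>, the index sets range over the subsets of the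
  following type. This is no restriction: the lemmas \<open>order_converges_toI\<close>,
  \<open>order_continuousD\<close>, \<open>order_closedD\<close> and \<open>coincide_any_index\<close> below give the corresponding
  statements for nets over arbitrary index types.
\<close>

type_synonym 'a net_index = "'a \<times> 'a set"

definition order_converges_to ::
  "'i set \<Rightarrow> ('i \<Rightarrow> 'i \<Rightarrow> bool) \<Rightarrow> ('i \<Rightarrow> 'a::vector_lattice) \<Rightarrow> 'a \<Rightarrow> bool" where
  "order_converges_to A r x l \<longleftrightarrow>
     (\<exists>(B :: 'a net_index set) s y. directed_set B s \<and> decreasing_to B s y 0 \<and>
        (\<forall>\<beta>\<in>B. \<exists>\<alpha>\<^sub>0\<in>A. \<forall>\<alpha>\<in>A. r \<alpha>\<^sub>0 \<alpha> \<longrightarrow> \<bar>x \<alpha> - l\<bar> \<le> y \<beta>))"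

definition order_continuous :: "'a::normed_lattice itself \<Rightarrow> bool" where
  "order_continuous _ \<longleftrightarrow>
     (\<forall>(A :: 'a net_index set) r (x :: 'a net_index \<Rightarrow> 'a).
        directed_set A r \<and> decreasing_to A r x 0 \<longrightarrow> decreasing_to A r (\<lambda>\<alpha>. norm (x \<alpha>)) 0)"

definition solid :: "'a::vector_lattice set \<Rightarrow> bool" where
  "solid S \<longleftrightarrow> (\<forall>x\<in>S. \<forall>y. \<bar>y\<bar> \<le> \<bar>x\<bar> \<longrightarrow> y \<in> S)"

definition linear_topology :: "'a::real_vector topology \<Rightarrow> bool" where
  "linear_topology \<tau> \<longleftrightarrow> topspace \<tau> = UNIV \<and>
     continuous_map (prod_topology \<tau> \<tau>) \<tau> (\<lambda>(x, y). x + y) \<and>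
     continuous_map (prod_topology euclideanreal \<tau>) \<tau> (\<lambda>(c, x). c *\<^sub>R x)"

definition locally_solid :: "'a::vector_lattice topology \<Rightarrow> bool" where
  "locally_solid \<tau> \<longleftrightarrow> linear_topology \<tau> \<and>
     (\<forall>U. openin \<tau> U \<and> 0 \<in> U \<longrightarrow> (\<exists>S. solid S \<and> 0 \<in> \<tau> interior_of S \<and> S \<subseteq> U))"

definition atom :: "'a::vector_lattice \<Rightarrow> bool" where
  "atom a \<longleftrightarrow> 0 < a \<and> (\<forall>y\<in>{0..a}. \<exists>c\<ge>0. y = c *\<^sub>R a)"

definition order_closed :: "'a::vector_lattice set \<Rightarrow> bool" where
  "order_closed S \<longleftrightarrow>
     (\<forall>(A :: 'a net_index set) r x l.
        directed_set A r \<and> x ` A \<subseteq> S \<and> order_converges_to A r x l \<longrightarrow> l \<in> S)"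

definition band :: "'a::vector_lattice set \<Rightarrow> bool" where
  "band S \<longleftrightarrow> subspace S \<and> solid S \<and> order_closed S"

definition atomic :: "'a::vector_lattice itself \<Rightarrow> bool" where
  "atomic _ \<longleftrightarrow> band hull {a :: 'a. atom a} = UNIV"


lemma directed_setD:
  assumes "directed_set A r"
  shows "A \<noteq> {}" "a \<in> A \<Longrightarrow> r a a"
    "a \<in> A \<Longrightarrow> b \<in> A \<Longrightarrow> c \<in> A \<Longrightarrow> r a b \<Longrightarrow> r b c \<Longrightarrow> r a c"
    "a \<in> A \<Longrightarrow> b \<in> A \<Longrightarrow> \<exists>c\<in>A. r a c \<and> r b c"
proof -
  from assms have 1: "A \<noteq> {}" "reflp_on A r" "transp_on A r"
    and 2: "\<forall>a\<in>A. \<forall>b\<in>A. \<exists>c\<in>A. r a c \<and> r b c"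
    unfolding directed_set_def by - (elim conjE, assumption)+
  show "A \<noteq> {}" by (rule 1(1))
  show "r a a" if "a \<in> A" using reflp_onD[OF 1(2) that] .
  show "r a c" if "a \<in> A" "b \<in> A" "c \<in> A" "r a b" "r b c"
    using transp_onD[OF 1(3) that] .
  show "\<exists>c\<in>A. r a c \<and> r b c" if "a \<in> A" "b \<in> A"
    using 2[rule_format, OF that] .
qed

lemma eventually_tail_filter:
  assumes "directed_set A r"
  shows "eventually P (tail_filter A r) \<longleftrightarrow> (\<exists>a\<in>A. \<forall>b\<in>A. r a b \<longrightarrow> P b)"
proof -
  have "eventually P (tail_filter A r) \<longleftrightarrow> (\<exists>a\<in>A. eventually P (principal {b \<in> A. r a b}))"
    unfolding tail_filter_def
  proof (rule eventually_INF_base)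
    show "A \<noteq> {}" using assms by (simp add: directed_set_def)
    fix a b assume ab: "a \<in> A" "b \<in> A"
    then obtain c where c: "c \<in> A" "r a c" "r b c"
      using directed_setD(4)[OF assms] by blast
    have "r a d \<and> r b d" if "d \<in> A" "r c d" for d
      using directed_setD(3)[OF assms] ab c that by blast
    with c show "\<exists>x\<in>A. principal {b \<in> A. r x b}
        \<le> inf (principal {b \<in> A. r a b}) (principal {d \<in> A. r b d})"
      by (intro bexI[of _ c]) auto
  qed
  then show ?thesis by (auto simp: eventually_principal)
qed

text \<open>A decreasing net may be indexed by its range, ordered by \<open>\<ge>\<close>.\<close>

lemma decreasing_reindex:
  fixes y :: "'i \<Rightarrow> 'a::order"
  assumes dir: "directed_set B s" and dec: "decreasing_to B s y l"
  defines "B' \<equiv> (\<lambda>z. (z, {})) ` y ` B :: 'a net_index set"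
    and "s' \<equiv> \<lambda>p q :: 'a net_index. fst q \<le> fst p"
  shows "directed_set B' s'" "decreasing_to B' s' fst l"
proof -
  have "\<exists>c\<in>B'. s' p c \<and> s' q c" if pq: "p \<in> B'" "q \<in> B'" for p q
  proof -
    from pq obtain a b where ab: "a \<in> B" "p = (y a, {})" "b \<in> B" "q = (y b, {})"
      unfolding B'_def by blast
    then obtain c where c: "c \<in> B" "s a c" "s b c"
      using directed_setD(4)[OF dir] by blast
    then have "y c \<le> y a" "y c \<le> y b"
      using dec ab by (simp_all add: decreasing_to_def)
    with ab c(1) show ?thesis
      by (intro bexI[of _ "(y c, {})"]) (simp_all add: B'_def s'_def)
  qed
  moreover have "B' \<noteq> {}"
    using directed_setD(1)[OF dir] by (simp add: B'_def)
  moreover have "reflp_on B' s'" "transp_on B' s'"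
    by (auto intro!: reflp_onI transp_onI simp: s'_def)
  ultimately show "directed_set B' s'"
    by (simp add: directed_set_def)
  from dec show "decreasing_to B' s' fst l"
    by (simp add: decreasing_to_def B'_def s'_def)
qed

lemma order_converges_toI:
  fixes x :: "'i \<Rightarrow> 'a::vector_lattice" and y :: "'j \<Rightarrow> 'a"
  assumes "directed_set B s" "decreasing_to B s y 0"
    and "\<And>\<beta>. \<beta> \<in> B \<Longrightarrow> \<exists>\<alpha>\<^sub>0\<in>A. \<forall>\<alpha>\<in>A. r \<alpha>\<^sub>0 \<alpha> \<longrightarrow> \<bar>x \<alpha> - l\<bar> \<le> y \<beta>"
  shows "order_converges_to A r x l"
proof -
  let ?B = "(\<lambda>z. (z, {})) ` y ` B :: 'a net_index set"
  have "\<forall>\<beta>\<in>?B. \<exists>\<alpha>\<^sub>0\<in>A. \<forall>\<alpha>\<in>A. r \<alpha>\<^sub>0 \<alpha> \<longrightarrow> \<bar>x \<alpha> - l\<bar> \<le> fst \<beta>"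
    using assms(3) by simp
  with decreasing_reindex[OF assms(1,2)] show ?thesis
    unfolding order_converges_to_def
    by (intro exI[of _ ?B] exI[of _ "\<lambda>p q. fst q \<le> fst p"] exI[of _ fst] conjI)
qed

lemma order_continuousD:
  fixes x :: "'i \<Rightarrow> 'a::normed_lattice"
  assumes "order_continuous TYPE('a)" and dir: "directed_set A r" and dec: "decreasing_to A r x 0"
  shows "decreasing_to A r (\<lambda>\<alpha>. norm (x \<alpha>)) 0"
proof -
  let ?A = "(\<lambda>z. (z, {})) ` x ` A :: 'a net_index set"
  have "decreasing_to ?A (\<lambda>p q. fst q \<le> fst p) (\<lambda>p. norm (fst p)) 0"
    using assms(1)[unfolded order_continuous_def, rule_format, OF conjI]
      decreasing_reindex[OF dir dec] .
  then show ?thesis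
    using dec by (simp add: decreasing_to_def)
qed

text \<open>
  Every net in \<open>'a\<close> has the same tails as one indexed by the pairs \<open>(z, T)\<close> with \<open>T\<close> a tail
  and \<open>z \<in> T\<close>, ordered by reverse inclusion of the tails.
\<close>

lemma net_reindex:
  fixes x :: "'i \<Rightarrow> 'a"
  assumes dir: "directed_set A r"
  obtains A' :: "'a net_index set" and r' x'
  where "directed_set A' r'" "x' ` A' = x ` A"
    "\<And>P. (\<exists>a\<in>A'. \<forall>b\<in>A'. r' a b \<longrightarrow> P (x' b)) \<longleftrightarrow> (\<exists>a\<in>A. \<forall>b\<in>A. r a b \<longrightarrow> P (x b))"
proof -
  define T where "T a = x ` {b \<in> A. r a b}" for a
  define A' where "A' = {(z, T a) |z a. a \<in> A \<and> z \<in> T a}"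
  define r' where "r' p q \<longleftrightarrow> snd q \<subseteq> snd p" for p q :: "'a net_index"
  have refl: "r a a" if "a \<in> A" for a
    using directed_setD(2)[OF dir] that .
  have tr: "r a c" if "r a b" "r b c" "a \<in> A" "b \<in> A" "c \<in> A" for a b c
    using directed_setD(3)[OF dir] that by blast
  have xT: "x a \<in> T a" if "a \<in> A" for a
    using refl that by (auto simp: T_def)
  have mono: "T b \<subseteq> T a" if "r a b" "a \<in> A" "b \<in> A" for a b
    using tr that by (auto simp: T_def)
  have mem: "(x a, T a) \<in> A'" if "a \<in> A" for a
    using xT[OF that] that by (auto simp: A'_def)
  show ?thesis
  proof (rule that[of A' r' fst])
    show "directed_set A' r'"
      unfolding directed_set_def
    proof (intro conjI ballI)
      show "A' \<noteq> {}" using directed_setD(1)[OF dir] mem by blast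
      show "reflp_on A' r'" "transp_on A' r'"
        by (auto intro!: reflp_onI transp_onI simp: r'_def)
      fix p q assume "p \<in> A'" "q \<in> A'"
      then obtain a b where ab: "a \<in> A" "b \<in> A" "snd p = T a" "snd q = T b"
        by (auto simp: A'_def)
      then obtain c where "c \<in> A" "r a c" "r b c"
        using directed_setD(4)[OF dir] by blast
      with ab show "\<exists>c\<in>A'. r' p c \<and> r' q c"
        by (intro bexI[of _ "(x c, T c)"]) (simp_all add: r'_def mem mono)
    qed
    show "fst ` A' = x ` A"
    proof
      show "fst ` A' \<subseteq> x ` A" by (auto simp: A'_def T_def)
      show "x ` A \<subseteq> fst ` A'" using mem by force
    qed
    show "(\<exists>a\<in>A'. \<forall>b\<in>A'. r' a b \<longrightarrow> P (fst b)) \<longleftrightarrow> (\<exists>a\<in>A. \<forall>b\<in>A. r a b \<longrightarrow> P (x b))" for P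
    proof
      assume "\<exists>p\<in>A'. \<forall>q\<in>A'. r' p q \<longrightarrow> P (fst q)"
      then obtain p where p: "p \<in> A'" and Pp: "\<And>q. q \<in> A' \<Longrightarrow> r' p q \<Longrightarrow> P (fst q)"
        by blast
      from p obtain a where a: "a \<in> A" "snd p = T a"
        by (auto simp: A'_def)
      have "P (x b)" if "b \<in> A" "r a b" for b
        using Pp[of "(x b, T b)"] mem[OF that(1)] mono[OF that(2) a(1) that(1)] a(2)
        by (simp add: r'_def)
      with a show "\<exists>a\<in>A. \<forall>b\<in>A. r a b \<longrightarrow> P (x b)" by blast
    next
      assume "\<exists>a\<in>A. \<forall>b\<in>A. r a b \<longrightarrow> P (x b)"
      then obtain a where a: "a \<in> A" and P: "\<And>z. z \<in> T a \<Longrightarrow> P z"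
        by (auto simp: T_def)
      have "P (fst q)" if "q \<in> A'" "r' (x a, T a) q" for q
        using that P by (auto simp: A'_def r'_def)
      with mem[OF a] show "\<exists>p\<in>A'. \<forall>q\<in>A'. r' p q \<longrightarrow> P (fst q)" by blast
    qed
  qed
qed

lemma order_closedD:
  fixes x :: "'i \<Rightarrow> 'a::vector_lattice"
  assumes "order_closed S" "directed_set A r" "x ` A \<subseteq> S" "order_converges_to A r x l"
  shows "l \<in> S"
proof -
  obtain A' :: "'a net_index set" and r' x' where 1: "directed_set A' r'" "x' ` A' = x ` A"
    and 2: "\<And>P. (\<exists>a\<in>A'. \<forall>b\<in>A'. r' a b \<longrightarrow> P (x' b)) \<longleftrightarrow> (\<exists>a\<in>A. \<forall>b\<in>A. r a b \<longrightarrow> P (x b))"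
    by (rule net_reindex[OF assms(2), of x]) (rule that)
  have "order_converges_to A' r' x' l"
    using assms(4) unfolding order_converges_to_def 2[of "\<lambda>z. \<bar>z - l\<bar> \<le> _"] .
  with assms(1,3) 1 show ?thesis
    unfolding order_closed_def by metis
qed

lemma coincide_any_index:
  fixes x :: "'i \<Rightarrow> 'a::vector_lattice"
  assumes coincide: "\<And>(A :: 'a net_index set) r x.
      directed_set A r \<Longrightarrow> x ` A \<subseteq> {u..v} \<Longrightarrow>
        order_converges_to A r x l \<longleftrightarrow> limitin \<tau> x l (tail_filter A r)"
    and dir: "directed_set A r" and "x ` A \<subseteq> {u..v}"
  shows "order_converges_to A r x l \<longleftrightarrow> limitin \<tau> x l (tail_filter A r)"
proof -
  obtain A' :: "'a net_index set" and r' x' where 1: "directed_set A' r'" "x' ` A' = x ` A"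
    and 2: "\<And>P. (\<exists>a\<in>A'. \<forall>b\<in>A'. r' a b \<longrightarrow> P (x' b)) \<longleftrightarrow> (\<exists>a\<in>A. \<forall>b\<in>A. r a b \<longrightarrow> P (x b))"
    by (rule net_reindex[OF dir, of x]) (rule that)
  have "order_converges_to A r x l \<longleftrightarrow> order_converges_to A' r' x' l"
    unfolding order_converges_to_def 2[of "\<lambda>z. \<bar>z - l\<bar> \<le> _"] ..
  moreover have "limitin \<tau> x l (tail_filter A r) \<longleftrightarrow> limitin \<tau> x' l (tail_filter A' r')"
    unfolding limitin_def eventually_tail_filter[OF dir] eventually_tail_filter[OF 1(1)]
      2[of "\<lambda>z. z \<in> _"] ..
  ultimately show ?thesis using coincide[OF 1(1), of x'] 1(2) assms(3) by simp
qed

end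

theory Submission
  imports Defs
begin

text \<open>
  The crux is that order convergence on an interval \<open>[0, x]\<close> can only be topological if \<open>x\<close>
  lies above an atom. On \<open>[0, x]\<close> a topology lets one form the net of all small elements: pairs
  of a neighbourhood of \<open>0\<close> and a member of it, ordered by shrinking the neighbourhood. This net
  converges to \<open>0\<close> in the topology, so it must converge in order, and that means that the
  members of a sufficiently small neighbourhood \<open>U\<close> have a common upper bound \<open>w\<close> that does not
  dominate \<open>x\<close> (\<open>order_topology_small_neighbourhood\<close>).

  Now suppose that \<open>x\<close> lies above no atom. Repeated splitting produces infinitely many pairwise
  disjoint positive elements \<open>d\<^sub>n\<close> below \<open>(x - w)\<^sup>+\<close> (\<open>atomless_disjoint_sequence\<close>). For suitable
  \<open>k\<^sub>n\<close> the truncated multiple \<open>e\<^sub>n = k\<^sub>n d\<^sub>n \<and> x\<close> does not lie below \<open>w\<close>: as \<open>k\<close> grows, \<open>k d\<^sub>n \<and> x\<close>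
  fills up \<open>x\<close> where \<open>d\<^sub>n\<close> lives, and there \<open>x\<close> exceeds \<open>w\<close> (\<open>truncated_multiples_escape\<close>). The \<open>e\<^sub>n\<close> are still disjoint and bounded by \<open>x\<close>, and such a
  sequence is order null in an Archimedean lattice (\<open>disjoint_sequence_order_null\<close>). Hence it is
  null in the topology, so some \<open>e\<^sub>n\<close> lies in \<open>U\<close> and therefore below \<open>w\<close>, a contradiction.

  Finally, if every positive element lies above an atom, then each \<open>x \<ge> 0\<close> is the supremum of
  the elements of \<open>[0, x]\<close> in any band that contains the atoms
  (\<open>band_containing_atoms_eq_UNIV\<close>), so that band is everything.
\<close>

section \<open>Disjoint sequences in normed lattices\<close>

lemma normed_lattice_archimedean:
  fixes u y :: "'a::normed_lattice"
  assumes "0 \<le> u" and bound: "\<And>n::nat. real n *\<^sub>R u \<le> y"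
  shows "u = 0"
proof (rule ccontr)
  assume "u \<noteq> 0"
  then have "norm u > 0" by simp
  then obtain n :: nat where n: "norm y < real n * norm u"
    using reals_Archimedean3 by blast
  have "\<bar>real n *\<^sub>R u\<bar> \<le> \<bar>y\<bar>"
    using assms(1) bound[of n] bound[of 0] by (simp add: scaleR_nonneg_nonneg)
  then have "norm (real n *\<^sub>R u) \<le> norm y" by (rule norm_abs_mono)
  with n show False by simp
qed

lemma disjoint_scaleR:
  fixes u v :: "'a::vector_lattice"
  assumes "0 \<le> u" "0 \<le> v" "inf u v = 0" "0 \<le> a" "0 \<le> b"
  shows "inf (a *\<^sub>R u) (b *\<^sub>R v) = 0"
proof (rule antisym)
  define m where "m = max 1 (max a b)"
  have m: "0 < m" "a \<le> m" "b \<le> m" by (auto simp: m_def)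
  let ?t = "inf (a *\<^sub>R u) (b *\<^sub>R v)"
  have "?t \<le> m *\<^sub>R u" "?t \<le> m *\<^sub>R v"
    using m assms by (auto intro: le_infI1 le_infI2 scaleR_right_mono)
  then have "inverse m *\<^sub>R ?t \<le> u" "inverse m *\<^sub>R ?t \<le> v"
    using m(1) by (simp_all add: pos_divideR_le_eq divideR_right)
  then have "inverse m *\<^sub>R ?t \<le> inf u v" by simp
  then have "m *\<^sub>R inverse m *\<^sub>R ?t \<le> m *\<^sub>R 0"
    using m(1) assms(3) by (intro scaleR_left_mono) auto
  then show "?t \<le> 0" using m(1) by simp
  show "0 \<le> ?t" using assms by (simp add: scaleR_nonneg_nonneg)
qed

lemma disjoint_add:
  fixes u v z :: "'a::vector_lattice"
  assumes "0 \<le> u" "0 \<le> v" "0 \<le> z" "inf u z = 0" "inf v z = 0"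
  shows "inf (u + v) z = 0"
proof (rule antisym)
  let ?t = "inf (u + v) z"
  have "?t - v \<le> u" by (simp add: diff_le_eq)
  moreover have "?t - v \<le> z" using assms(2) by (simp add: diff_le_eq add_increasing2 le_infI2)
  ultimately have "?t - v \<le> inf u z" by simp
  then have "?t \<le> v" using assms(4) by simp
  then have "?t \<le> inf v z" by simp
  then show "?t \<le> 0" using assms(5) by simp
  show "0 \<le> ?t" using assms by simp
qed

text \<open>
  Disjointness makes the partial sums \<open>s\<^sub>N\<close> suprema, hence bounded by \<open>x\<close>. If \<open>y\<close> is any upper bound
  of all partial sums, then \<open>y - s\<^sub>N\<close> dominates the tail from \<open>N\<close> on, and these bounds have
  infimum \<open>0\<close> even when there is no least \<open>y\<close>: a positive lower bound \<open>v\<close> of all of them turns each upper bound \<open>y\<close> into the smaller one \<open>y - v\<close>, and the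
  Archimedean property forces \<open>v = 0\<close>.
\<close>

lemma disjoint_sequence_order_null:
  fixes e :: "nat \<Rightarrow> 'a::normed_lattice"
  assumes nonneg: "\<And>n. 0 \<le> e n" and bound: "\<And>n. e n \<le> x"
    and disj: "\<And>m n. m < n \<Longrightarrow> inf (e m) (e n) = 0"
  shows "order_converges_to UNIV (\<le>) e 0"
proof -
  define s where "s N = (\<Sum>n<N. e n)" for N
  define B where "B = {b. \<exists>N. \<forall>n\<ge>N. e n \<le> b}"
  have s_nonneg: "0 \<le> s N" for N
    by (simp add: s_def nonneg sum_nonneg)
  have s_disj: "inf (s N) (e n) = 0" if "N \<le> n" for N n
    using that
  proof (induction N)
    case 0
    then show ?case by (simp add: s_def nonneg inf_absorb1)
  next
    case (Suc N)
    then have "inf (s N + e N) (e n) = 0"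
      by (intro disjoint_add) (auto simp: s_nonneg nonneg disj)
    then show ?case by (simp add: s_def)
  qed
  have s_bound: "s N \<le> x" for N
  proof (induction N)
    case 0
    then show ?case using order_trans[OF nonneg bound] by (simp add: s_def)
  next
    case (Suc N)
    have "s (Suc N) = sup (s N) (e N)"
      using add_eq_inf_sup[of "s N" "e N"] s_disj[of N N] by (simp add: s_def)
    then show ?case using Suc bound by simp
  qed
  have e_le: "e n \<le> s (Suc n) - s N" if "N \<le> n" for N n
  proof -
    have "s N \<le> s n" using that nonneg unfolding s_def by (intro sum_mono2) auto
    then show ?thesis by (simp add: s_def)
  qed
  have B_nonneg: "0 \<le> b" if "b \<in> B" for b
    using that nonneg by (auto simp: B_def intro: order_trans)
  have dec: "decreasing_to B (\<lambda>a b. b \<le> a) (\<lambda>b. b) 0"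
    unfolding decreasing_to_def
  proof (intro conjI allI impI ballI)
    fix v assume v: "\<forall>b\<in>B. v \<le> b"
    \<comment> \<open>\<open>v\<close> may be replaced by its positive part, since all members of \<open>B\<close> are positive.\<close>
    have v_le: "sup v 0 \<le> y - s N" if "\<And>k. s k \<le> y" for y N
    proof -
      have "e n \<le> y - s N" if "N \<le> n" for n
        using e_le[OF that] \<open>s (Suc n) \<le> y\<close> by (meson diff_right_mono order_trans)
      then have "y - s N \<in> B" by (auto simp: B_def)
      then show ?thesis using v B_nonneg[of "y - s N"] by (intro le_supI) auto
    qed
    have "s N \<le> x - real k *\<^sub>R sup v 0" for N k
    proof (induction k arbitrary: N)
      case 0
      then show ?case using s_bound by simp
    next
      case (Suc k)
      from v_le[OF Suc, of N] show ?case
        by (simp add: algebra_simps)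
    qed
    from this[of 0] have "real k *\<^sub>R sup v 0 \<le> x" for k
      by (simp add: s_def)
    then have "sup v 0 = 0" by (intro normed_lattice_archimedean) auto
    then show "v \<le> 0" by (simp add: sup.absorb_iff2)
  qed (auto simp: B_nonneg)
  have "directed_set B (\<lambda>a b. b \<le> a)"
    unfolding directed_set_def
  proof (intro conjI ballI)
    show "B \<noteq> {}" using bound by (auto simp: B_def)
    show "reflp_on B (\<lambda>a b. b \<le> a)" "transp_on B (\<lambda>a b. b \<le> a)"
      by (auto intro!: reflp_onI transp_onI)
    fix a b assume "a \<in> B" "b \<in> B"
    then obtain M N where "\<forall>n\<ge>M. e n \<le> a" "\<forall>n\<ge>N. e n \<le> b"
      by (auto simp: B_def)
    then have "\<forall>n\<ge>max M N. e n \<le> inf a b" by simp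
    then have "inf a b \<in> B" unfolding B_def by blast
    then show "\<exists>c\<in>B. c \<le> a \<and> c \<le> b"
      by (intro bexI[of _ "inf a b"]) auto
  qed
  then show ?thesis
    using dec by (rule order_converges_toI) (simp add: B_def nonneg)
qed

section \<open>Elements above no atom\<close>

text \<open>
  Take \<open>y\<close> in \<open>[0, z]\<close> that is no multiple of \<open>z\<close>. If \<open>y\<close> were comparable with every \<open>c z\<close>, a
  Dedekind cut argument would locate \<open>y\<close> at distance \<open>0\<close> from a multiple of \<open>z\<close>. So some \<open>c z\<close> is
  incomparable with \<open>y\<close>, and the positive and negative parts of \<open>y - c z\<close> are the two pieces.
\<close>

lemma atomless_split:
  fixes z :: "'a::normed_lattice"
  assumes z: "0 < z" and no_atom: "\<not> atom z"
  obtains u v where "0 < u" "0 < v" "u \<le> z" "v \<le> z" "inf u v = 0"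
proof -
  from assms obtain y where y: "0 \<le> y" "y \<le> z" and ne: "\<And>c. 0 \<le> c \<Longrightarrow> y \<noteq> c *\<^sub>R z"
    by (auto simp: atom_def)
  have "\<exists>c\<ge>0. \<not> c *\<^sub>R z \<le> y \<and> \<not> y \<le> c *\<^sub>R z"
  proof (rule ccontr)
    assume "\<not> ?thesis"
    then have cmp: "c *\<^sub>R z \<le> y \<or> y \<le> c *\<^sub>R z" if "0 \<le> c" for c
      using that by blast
    define C where "C = {c. 0 \<le> c \<and> c *\<^sub>R z \<le> y}"
    have C0: "0 \<in> C" using y by (simp add: C_def)
    have C1: "c \<le> 1" if "c \<in> C" for c
    proof (rule ccontr)
      assume "\<not> c \<le> 1"
      then have "0 < c - 1" by simp
      have "c *\<^sub>R z \<le> z" using that y by (auto simp: C_def)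
      then have "(c - 1) *\<^sub>R z \<le> 0" by (simp add: algebra_simps)
      then show False using \<open>0 < c - 1\<close> z by (simp add: scaleR_le_0_iff)
    qed
    then have bdd: "bdd_above C" by (rule bdd_aboveI)
    define c where "c = Sup C"
    have c: "0 \<le> c" unfolding c_def using C0 bdd by (rule cSup_upper)
    have "norm (y - c *\<^sub>R z) \<le> \<epsilon> * norm z" if \<epsilon>: "0 < \<epsilon>" for \<epsilon>
    proof -
      have "y \<le> (c + \<epsilon>) *\<^sub>R z"
      proof (rule ccontr)
        assume "\<not> y \<le> (c + \<epsilon>) *\<^sub>R z"
        then have "c + \<epsilon> \<in> C" using cmp[of "c + \<epsilon>"] c \<epsilon> by (auto simp: C_def)
        then have "c + \<epsilon> \<le> c" unfolding c_def using bdd by (rule cSup_upper)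
        then show False using \<epsilon> by simp
      qed
      moreover have "(c - \<epsilon>) *\<^sub>R z \<le> y"
      proof -
        have "c - \<epsilon> < Sup C" using \<epsilon> by (simp add: c_def)
        then obtain b where "b \<in> C" "c - \<epsilon> < b"
          using less_cSup_iff[OF _ bdd] C0 by blast
        have "(c - \<epsilon>) *\<^sub>R z \<le> b *\<^sub>R z"
          using \<open>c - \<epsilon> < b\<close> z by (intro scaleR_right_mono) auto
        then show ?thesis using \<open>b \<in> C\<close> by (auto simp: C_def)
      qed
      ultimately have "y - c *\<^sub>R z \<le> \<epsilon> *\<^sub>R z" "- (y - c *\<^sub>R z) \<le> \<epsilon> *\<^sub>R z"
        by (simp_all add: algebra_simps)
      then have "\<bar>y - c *\<^sub>R z\<bar> \<le> \<bar>\<epsilon> *\<^sub>R z\<bar>"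
        by (intro abs_leI) (erule order_trans, rule abs_ge_self)+
      then have "norm (y - c *\<^sub>R z) \<le> norm (\<epsilon> *\<^sub>R z)" by (rule norm_abs_mono)
      then show ?thesis using \<epsilon> by simp
    qed
    note close = this
    have "norm z > 0" using z by auto
    then have "norm (y - c *\<^sub>R z) \<le> 0 + \<delta>" if "0 < \<delta>" for \<delta>
      using close[of "\<delta> / norm z"] that by simp
    then have "norm (y - c *\<^sub>R z) \<le> 0" by (rule field_le_epsilon)
    then show False using ne[OF c] by simp
  qed
  then obtain c where c: "0 \<le> c" "\<not> c *\<^sub>R z \<le> y" "\<not> y \<le> c *\<^sub>R z" by blast
  have c1: "c \<le> 1"
  proof (rule ccontr)
    assume "\<not> c \<le> 1"
    then have "1 *\<^sub>R z \<le> c *\<^sub>R z" using z by (intro scaleR_right_mono) auto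
    then show False using c(3) y(2) by auto
  qed
  define u v where "u = y - inf y (c *\<^sub>R z)" and "v = c *\<^sub>R z - inf y (c *\<^sub>R z)"
  have cz: "0 \<le> c *\<^sub>R z" "c *\<^sub>R z \<le> z"
    using c(1) c1 z scaleR_right_mono[of c 1 z] by (auto simp: scaleR_nonneg_nonneg)
  have inf0: "0 \<le> inf y (c *\<^sub>R z)" using y cz by simp
  show thesis
  proof (rule that)
    have "inf y (c *\<^sub>R z) < y" using c(3) by (simp add: less_le_not_le)
    then show "0 < u" by (simp only: u_def diff_gt_0_iff_gt)
    have "inf y (c *\<^sub>R z) < c *\<^sub>R z" using c(2) by (simp add: less_le_not_le)
    then show "0 < v" by (simp only: v_def diff_gt_0_iff_gt)
    show "u \<le> z" unfolding u_def diff_le_eq using y(2) inf0 by (rule add_increasing2[rotated])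
    show "v \<le> z" unfolding v_def diff_le_eq using cz(2) inf0 by (rule add_increasing2[rotated])
    show "inf u v = 0"
      using add_inf_distrib_right[of y "c *\<^sub>R z" "- inf y (c *\<^sub>R z)"]
      by (simp only: u_def v_def add_uminus_conv_diff diff_self)
  qed
qed

lemma atomless_disjoint_sequence:
  fixes z :: "'a::normed_lattice"
  assumes z: "0 < z" and no_atom: "\<And>a. atom a \<Longrightarrow> \<not> a \<le> z"
  obtains d :: "nat \<Rightarrow> 'a" where "\<And>n. 0 < d n" "\<And>n. d n \<le> z"
    "\<And>m n. m < n \<Longrightarrow> inf (d m) (d n) = 0"
proof -
  define P where "P p \<longleftrightarrow> 0 < fst p \<and> 0 < snd p \<and> fst p \<le> z \<and> snd p \<le> z \<and> inf (fst p) (snd p) = 0"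
    for p :: "'a \<times> 'a"
  have split: "\<exists>p. P p \<and> fst p \<le> t \<and> snd p \<le> t" if t: "0 < t" "t \<le> z" for t
  proof -
    have "\<not> atom t" using no_atom t by blast
    then obtain u v where "0 < u" "0 < v" "u \<le> t" "v \<le> t" "inf u v = 0"
      using atomless_split t(1) by blast
    then show ?thesis using t(2) by (intro exI[of _ "(u, v)"]) (auto simp: P_def)
  qed
  \<comment> \<open>Of each pair the first entry is kept for the sequence and the second is split further.\<close>
  have "\<exists>f. \<forall>n::nat. P (f n) \<and> (fst (f (Suc n)) \<le> snd (f n) \<and> snd (f (Suc n)) \<le> snd (f n))"
  proof (rule dependent_nat_choice)
    show "\<exists>p. P p" using split[OF z] by auto
    show "\<exists>q. P q \<and> fst q \<le> snd p \<and> snd q \<le> snd p" if "P p" for p and n :: nat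
      using split[of "snd p"] that by (auto simp: P_def)
  qed
  then obtain f :: "nat \<Rightarrow> 'a \<times> 'a" where f: "\<And>n. P (f n)"
    "\<And>n. fst (f (Suc n)) \<le> snd (f n)" "\<And>n. snd (f (Suc n)) \<le> snd (f n)" by blast
  have anti: "snd (f n) \<le> snd (f m)" if "m \<le> n" for m n
    using that f(3) lift_Suc_antimono_le[of "\<lambda>n. snd (f n)"] by blast
  show thesis
  proof (rule that)
    show "0 < fst (f n)" "fst (f n) \<le> z" for n using f(1)[of n] by (auto simp: P_def)
    show "inf (fst (f m)) (fst (f n)) = 0" if "m < n" for m n
    proof (rule antisym)
      from that obtain k where k: "n = Suc k" "m \<le> k" by (cases n) auto
      have "fst (f n) \<le> snd (f m)" using f(2)[of k] anti[OF k(2)] k(1) by auto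
      then have "inf (fst (f m)) (fst (f n)) \<le> inf (fst (f m)) (snd (f m))"
        by (rule inf_mono[OF order_refl])
      also have "\<dots> = 0" using f(1)[of m] by (simp add: P_def)
      finally show "inf (fst (f m)) (fst (f n)) \<le> 0" .
      show "0 \<le> inf (fst (f m)) (fst (f n))"
        using f(1)[of m] f(1)[of n] by (simp add: P_def less_imp_le)
    qed
  qed
qed

text \<open>
  This is what distributivity gives from \<open>t = t \<and> (x \<or> w)\<close>; the identity
  \<open>t + x = (t \<and> x) + (t \<or> x)\<close> yields it directly.
\<close>

lemma le_if_inf_le_le_sup:
  fixes t x w :: "'a::lattice_ab_group_add"
  assumes "inf t x \<le> w" "t \<le> sup x w"
  shows "t \<le> w"
proof -
  have "t + x = inf t x + sup t x" by (rule add_eq_inf_sup[of t x, unfolded add.commute[of "sup t x"]])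
  also have "\<dots> \<le> inf t x + sup x w"
    using assms(2) by (intro add_left_mono le_supI sup.cobounded1)
  also have "\<dots> = sup (inf t x + x) (inf t x + w)" by (rule add_sup_distrib_left)
  also have "\<dots> \<le> w + x"
  proof (rule le_supI)
    show "inf t x + x \<le> w + x" using assms(1) by (rule add_right_mono)
    show "inf t x + w \<le> w + x"
      unfolding add.commute[of "inf t x" w] by (rule add_left_mono) (rule inf.cobounded2)
  qed
  finally show ?thesis by (rule add_le_imp_le_right)
qed

text \<open>
  If all truncated multiples stayed below \<open>w\<close>, so would the multiples themselves: from
  \<open>k d \<le> w\<close> one gets \<open>(k + 1) d \<le> (x - w)\<^sup>+ + w = x \<or> w\<close>, and the part of it below \<open>x\<close> is
  below \<open>w\<close> by assumption.
\<close>

lemma truncated_multiples_escape: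
  fixes d x w :: "'a::normed_lattice"
  assumes d: "0 < d" "d \<le> sup (x - w) 0" and w: "0 \<le> w"
  obtains k :: nat where "\<not> inf (real k *\<^sub>R d) x \<le> w"
proof (rule ccontr)
  assume "\<not> thesis"
  then have trunc: "inf (real k *\<^sub>R d) x \<le> w" for k using that by blast
  have dw: "d + w \<le> sup x w"
    using add_right_mono[OF d(2), of w] by (simp add: add_sup_distrib_right)
  have "real k *\<^sub>R d \<le> w" for k
  proof (induction k)
    case 0
    then show ?case using w by simp
  next
    case (Suc k)
    let ?t = "real (Suc k) *\<^sub>R d"
    have "?t = d + real k *\<^sub>R d" by (simp add: algebra_simps)
    also have "\<dots> \<le> d + w" using Suc by (rule add_left_mono)
    finally have "?t \<le> sup x w" using dw by (rule order_trans)
    with trunc[of "Suc k"] show ?case by (rule le_if_inf_le_le_sup)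
  qed
  then have "d = 0" using d(1) by (intro normed_lattice_archimedean) auto
  then show False using d(1) by simp
qed

section \<open>Topologies that describe order convergence on an interval\<close>

text \<open>
  The net consists of all pairs of an open neighbourhood of \<open>0\<close> and a member of it in \<open>[0, x]\<close>.
  Because its tails contain every member of a neighbourhood, an element dominating a tail bounds
  a whole neighbourhood; and as the dominating net has infimum \<open>0\<close>, not all of its terms can lie
  above \<open>x\<close>.
\<close>

lemma order_topology_small_neighbourhood:
  fixes \<tau> :: "'a::vector_lattice topology"
  assumes top: "topspace \<tau> = UNIV"
    and conv: "\<And>(A :: 'a net_index set) r y.
      directed_set A r \<Longrightarrow> y ` A \<subseteq> {0..x} \<Longrightarrow> limitin \<tau> y 0 (tail_filter A r) \<Longrightarrow>
        order_converges_to A r y 0"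
    and x: "0 < x"
  obtains U w where "openin \<tau> U" "0 \<in> U" "0 \<le> w" "\<not> x \<le> w" "\<And>y. y \<in> U \<Longrightarrow> y \<in> {0..x} \<Longrightarrow> y \<le> w"
proof -
  define A where "A = {(y, U). openin \<tau> U \<and> 0 \<in> U \<and> y \<in> U \<and> y \<in> {0..x}}"
  define r where "r p q \<longleftrightarrow> snd q \<subseteq> snd p" for p q :: "'a net_index"
  have mem0: "(0, U) \<in> A" if "openin \<tau> U" "0 \<in> U" for U
    using that x by (simp add: A_def)
  have dir: "directed_set A r"
    unfolding directed_set_def
  proof (intro conjI ballI)
    show "A \<noteq> {}" using mem0[of UNIV] openin_topspace[of \<tau>] top by auto
    show "reflp_on A r" "transp_on A r"
      by (auto intro!: reflp_onI transp_onI simp: r_def)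
    fix p q assume "p \<in> A" "q \<in> A"
    then show "\<exists>c\<in>A. r p c \<and> r q c"
      by (intro bexI[of _ "(0, snd p \<inter> snd q)"] mem0) (auto simp: A_def r_def)
  qed
  have "limitin \<tau> fst 0 (tail_filter A r)"
    unfolding limitin_def eventually_tail_filter[OF dir]
  proof (intro conjI allI impI)
    show "0 \<in> topspace \<tau>" by (simp add: top)
    fix U assume U: "openin \<tau> U \<and> 0 \<in> U"
    have "fst b \<in> U" if "b \<in> A" "r (0, U) b" for b
      using that by (auto simp: A_def r_def)
    with U mem0 show "\<exists>a\<in>A. \<forall>b\<in>A. r a b \<longrightarrow> fst b \<in> U" by blast
  qed
  moreover have "fst ` A \<subseteq> {0..x}" by (auto simp: A_def)
  ultimately have "order_converges_to A r fst 0" using conv[OF dir] by blast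
  then obtain B :: "'a net_index set" and s g where dec: "decreasing_to B s g 0"
    and dom: "\<And>\<beta>. \<beta> \<in> B \<Longrightarrow> \<exists>\<alpha>\<^sub>0\<in>A. \<forall>\<alpha>\<in>A. r \<alpha>\<^sub>0 \<alpha> \<longrightarrow> \<bar>fst \<alpha> - 0\<bar> \<le> g \<beta>"
    unfolding order_converges_to_def by blast
  have "\<exists>\<beta>\<in>B. \<not> x \<le> g \<beta>"
    using dec x by (auto simp: decreasing_to_def)
  then obtain \<beta> where \<beta>: "\<beta> \<in> B" "\<not> x \<le> g \<beta>" by blast
  from dom[OF \<beta>(1)] obtain p where p: "p \<in> A" "\<And>q. q \<in> A \<Longrightarrow> r p q \<Longrightarrow> \<bar>fst q\<bar> \<le> g \<beta>"
    by auto
  show thesis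
  proof (rule that[of "snd p" "g \<beta>"])
    show "openin \<tau> (snd p)" "0 \<in> snd p" using p(1) by (auto simp: A_def)
    show "0 \<le> g \<beta>" using dec \<beta>(1) by (simp add: decreasing_to_def)
    show "\<not> x \<le> g \<beta>" by (rule \<beta>(2))
    show "y \<le> g \<beta>" if "y \<in> snd p" "y \<in> {0..x}" for y
    proof -
      have "(y, snd p) \<in> A" using that p(1) by (auto simp: A_def)
      then have "\<bar>y\<bar> \<le> g \<beta>" using p(2)[of "(y, snd p)"] by (simp add: r_def)
      then show ?thesis by (meson abs_ge_self order_trans)
    qed
  qed
qed

text \<open>
  Without an atom below \<open>x\<close> the two directions of the equivalence contradict each other.
  Topological convergence forcing order convergence bounds a neighbourhood of \<open>0\<close> by some \<open>w\<close> not
  above \<open>x\<close>; order convergence forcing topological convergence drives every disjoint sequence into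
  that neighbourhood, including one whose members are not below \<open>w\<close>.
\<close>

lemma order_topology_imp_atom_below:
  fixes \<tau> :: "'a::normed_lattice topology"
  assumes top: "topspace \<tau> = UNIV"
    and coincide: "\<And>(A :: 'a net_index set) r y.
      directed_set A r \<Longrightarrow> y ` A \<subseteq> {0..x} \<Longrightarrow>
        order_converges_to A r y 0 \<longleftrightarrow> limitin \<tau> y 0 (tail_filter A r)"
    and x: "0 < x"
  obtains a where "atom a" "a \<le> x"
proof (rule ccontr)
  assume "\<not> thesis"
  then have no_atom: "\<not> a \<le> x" if "atom a" for a
    using that \<open>\<And>a. atom a \<Longrightarrow> a \<le> x \<Longrightarrow> thesis\<close> by blast
  note conv = iffD2[OF coincide]
  obtain U w where U: "openin \<tau> U" "0 \<in> U" and w: "0 \<le> w" "\<not> x \<le> w"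
    and small: "\<And>y. y \<in> U \<Longrightarrow> y \<in> {0..x} \<Longrightarrow> y \<le> w"
    by (rule order_topology_small_neighbourhood[OF top conv x]) (assumption | rule that)+
  let ?z = "sup (x - w) 0"
  have "0 < ?z" using w(2) by (simp add: less_le_not_le)
  moreover have "?z \<le> x" using w(1) x by (simp add: diff_le_eq add_increasing2 less_imp_le)
  then have "\<not> a \<le> ?z" if "atom a" for a
    using no_atom[OF that] order_trans by blast
  ultimately obtain d :: "nat \<Rightarrow> 'a" where d: "\<And>n. 0 < d n" "\<And>n. d n \<le> ?z"
    and disj: "\<And>m n. m < n \<Longrightarrow> inf (d m) (d n) = 0"
    by (rule atomless_disjoint_sequence) blast+
  have "\<exists>k::nat. \<not> inf (real k *\<^sub>R d n) x \<le> w" for n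
    using truncated_multiples_escape[OF d(1) d(2) w(1)] by blast
  then obtain k :: "nat \<Rightarrow> nat" where k: "\<And>n. \<not> inf (real (k n) *\<^sub>R d n) x \<le> w"
    by metis
  define e where "e n = inf (real (k n) *\<^sub>R d n) x" for n
  have e: "0 \<le> e n" "e n \<le> x" for n
    using d(1)[of n] x by (simp_all add: e_def scaleR_nonneg_nonneg less_imp_le)
  have "inf (e m) (e n) = 0" if "m < n" for m n
  proof (rule antisym)
    have "inf (e m) (e n) \<le> inf (real (k m) *\<^sub>R d m) (real (k n) *\<^sub>R d n)"
      unfolding e_def by (intro inf_mono inf.cobounded1)
    also have "\<dots> = 0"
      using d(1) disj[OF that] by (intro disjoint_scaleR) (auto intro: less_imp_le)
    finally show "inf (e m) (e n) \<le> 0" .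
    show "0 \<le> inf (e m) (e n)" using e by simp
  qed
  then have "order_converges_to UNIV (\<le>) e 0"
    using e disjoint_sequence_order_null by blast
  moreover have dir: "directed_set (UNIV :: nat set) (\<le>)"
    unfolding directed_set_def
    by (auto intro!: reflp_onI transp_onI) (meson max.cobounded1 max.cobounded2)
  moreover have "range e \<subseteq> {0..x}" using e by auto
  ultimately have "limitin \<tau> e 0 (tail_filter UNIV (\<le>))"
    using coincide_any_index[OF coincide] by blast
  then obtain N where "e N \<in> U"
    using U unfolding limitin_def eventually_tail_filter[OF dir] by blast
  then have "e N \<le> w" using small e by simp
  then show False using k by (simp add: e_def)
qed

section \<open>Atoms generate\<close>

text \<open>
  For \<open>x \<ge> 0\<close> let \<open>D\<close> be the part of \<open>S\<close> in \<open>[0, x]\<close>, which is directed upwards. If it had an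
  upper bound \<open>u\<close> not above \<open>x\<close>, an atom \<open>a\<close> below \<open>x - (u \<and> x)\<close> could be added to any member of
  \<open>D\<close> without leaving \<open>D\<close>; then all multiples of \<open>a\<close> would be below \<open>x\<close>. So \<open>D\<close> increases to \<open>x\<close>,
  and \<open>S\<close> is order closed.
\<close>

lemma band_containing_atoms_eq_UNIV:
  fixes S :: "'a::normed_lattice set"
  assumes S: "band S" and atoms: "\<And>a. atom a \<Longrightarrow> a \<in> S"
    and below: "\<And>x :: 'a. 0 < x \<Longrightarrow> \<exists>a. atom a \<and> a \<le> x"
  shows "S = UNIV"
proof -
  have sub: "subspace S" and sol: "solid S" and oc: "order_closed S"
    using S by (auto simp: band_def)
  have solidD: "y \<in> S" if "0 \<le> y" "y \<le> t" "t \<in> S" for y t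
    using sol that by (auto simp: solid_def intro: order_trans)
  have pos: "x \<in> S" if x: "0 \<le> x" for x
  proof -
    define D where "D = {y \<in> S. 0 \<le> y \<and> y \<le> x}"
    have D0: "0 \<in> D" using x sub by (simp add: D_def subspace_0)
    have dir: "directed_set D (\<le>)"
      unfolding directed_set_def
    proof (intro conjI ballI)
      show "D \<noteq> {}" using D0 by blast
      show "reflp_on D (\<le>)" "transp_on D (\<le>)"
        by (auto intro!: reflp_onI transp_onI)
      fix a b assume ab: "a \<in> D" "b \<in> D"
      have "sup a b \<le> a + b" using ab by (simp add: D_def)
      moreover have "a + b \<in> S" using ab sub by (simp add: D_def subspace_add)
      ultimately have "sup a b \<in> S" using ab by (intro solidD[of "sup a b" "a + b"]) (auto simp: D_def le_supI1)
      then have "sup a b \<in> D" using ab by (auto simp: D_def le_supI1)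
      then show "\<exists>c\<in>D. a \<le> c \<and> b \<le> c" by (intro bexI[of _ "sup a b"]) auto
    qed
    have sup_D: "x \<le> u" if u: "\<And>y. y \<in> D \<Longrightarrow> y \<le> u" for u
    proof (rule ccontr)
      assume "\<not> x \<le> u"
      then have "inf u x < x" by (simp add: less_le_not_le)
      then have "0 < x - inf u x" by (simp only: diff_gt_0_iff_gt)
      then obtain a where a: "atom a" "a \<le> x - inf u x" using below by blast
      have a0: "0 < a" using a(1) by (simp add: atom_def)
      have "real n *\<^sub>R a \<in> D" for n
      proof (induction n)
        case 0
        then show ?case using D0 by simp
      next
        case (Suc n)
        have "real n *\<^sub>R a \<le> inf u x" using Suc u by (simp add: D_def)
        then have "a + real n *\<^sub>R a \<le> a + inf u x" by (rule add_left_mono)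
        also have "\<dots> \<le> x" using a(2) by (simp only: le_diff_eq)
        finally have "real n *\<^sub>R a + a \<le> x" by (simp only: add.commute)
        moreover have "real n *\<^sub>R a + a \<in> S"
          using Suc atoms[OF a(1)] sub by (simp add: D_def subspace_add)
        moreover have "0 \<le> real n *\<^sub>R a + a" using a0 Suc by (simp add: D_def)
        ultimately show ?case by (simp add: D_def algebra_simps)
      qed
      then have "real n *\<^sub>R a \<le> x" for n by (simp add: D_def)
      then have "a = 0" using a0 by (intro normed_lattice_archimedean) auto
      then show False using a0 by simp
    qed
    have "decreasing_to D (\<le>) (\<lambda>y. x - y) 0"
      unfolding decreasing_to_def
    proof (intro conjI allI impI ballI)
      fix v assume v: "\<forall>y\<in>D. v \<le> x - y"
      have "x \<le> x - v" by (rule sup_D) (use v in \<open>simp add: algebra_simps\<close>)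
      then show "v \<le> 0" by simp
    qed (auto simp: D_def)
    with dir have "order_converges_to D (\<le>) (\<lambda>y. y) x"
    proof (rule order_converges_toI)
      fix b assume "b \<in> D"
      then show "\<exists>a\<in>D. \<forall>y\<in>D. a \<le> y \<longrightarrow> \<bar>y - x\<bar> \<le> x - b"
        by (intro bexI[of _ b]) (auto simp: D_def abs_minus_commute)
    qed
    then show ?thesis
      by (rule order_closedD[OF oc dir, rotated]) (auto simp: D_def)
  qed
  have "x \<in> S" for x
  proof -
    have "pprt x + nprt x \<in> S"
      using pos[of "pprt x"] pos[of "- nprt x"] subspace_add[OF sub] subspace_neg[OF sub, of "- nprt x"]
      by simp
    then show ?thesis by (simp flip: prts)
  qed
  then show ?thesis by blast
qed

theorem theorem4:
  fixes \<tau> :: "'a::banach_lattice topology"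
  assumes "order_continuous TYPE('a)"
    and "locally_solid \<tau>"
    and "Hausdorff_space \<tau>"
    and "\<And>u v (A :: 'a net_index set) r x l.
      u \<le> v \<Longrightarrow> directed_set A r \<Longrightarrow> x ` A \<subseteq> {u..v} \<Longrightarrow> l \<in> {u..v} \<Longrightarrow>
        order_converges_to A r x l \<longleftrightarrow> limitin \<tau> x l (tail_filter A r)"
  shows "atomic TYPE('a)"
proof -
  have top: "topspace \<tau> = UNIV"
    using assms(2) by (simp add: locally_solid_def linear_topology_def)
  have "\<exists>a. atom a \<and> a \<le> x" if "0 < x" for x :: 'a
  proof -
    obtain a where "atom a" "a \<le> x"
    proof (rule order_topology_imp_atom_below[OF top _ \<open>0 < x\<close>])
      show "order_converges_to A r y 0 \<longleftrightarrow> limitin \<tau> y 0 (tail_filter A r)"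
        if "directed_set A r" "y ` A \<subseteq> {0..x}" for A :: "'a net_index set" and r y
        using assms(4)[OF _ that] \<open>0 < x\<close> by (simp add: less_imp_le)
    qed
    then show ?thesis by blast
  qed
  then have "S = UNIV" if "band S" "{a :: 'a. atom a} \<subseteq> S" for S
    using band_containing_atoms_eq_UNIV that by blast
  then show ?thesis
    by (auto simp: atomic_def hull_def)
qed

end
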